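(* For every graph program $P$ and all assertions $c,d$: if the triple $\{c\}\,P\,\{d\}$ is partially correct, then $\{c\}\,P\,\{d\}$ is derivable in the calculus SEM.
   Context: GP 2 host graphs. Let Char be the set of printable ASCII characters other than the double quote, and $\mathbb{L}=(\mathbb{Z}\cup \mathrm{Char}^* )^*$ the set of host labels. Node marks are none, red, green, blue, grey; edge marks are none, red, green, blue, dashed. A host graph is $G=\langle V_G,E_G,s_G,t_G,\ell_G,m_G,p_G\rangle$ with finite node and edge sets, source and target maps, total maps assigning every node and edge a label in $\mathbb{L}$ and a mark, and a root map $p_G\colon V_G\to\{0,1\}$. Conditional rule schemata. GP 2 expressions are lists built from empty, integer and string constants, typed variables (types list, atom, int, string, char), ':' , '.', $+,-,*,/$, indeg(n), outdeg(n), length(x). A conditional rule schema $\langle L\leftarrow K\to R,\Gamma\rangle$ consists of totally labelled rule graphs $L,R$ (like host graphs but labelled by expressions, marks possibly the wildcard any), an interface $K$ of unlabelled nodes included in both, all variables of $R$ occurring in $L$, and an application condition $\Gamma$ (Boolean combination of type tests, list (dis)equalities, integer comparisons and edge predicates). $G\Rightarrow H$ via an injective premorphism $g\colon L\to G$ and an assignment $\alpha$ of the variables (and of concrete marks to any-marks) if $g\colon L^{g,\alpha}\to G$ preserves labels, marks and roots, $\Gamma^{g,\alpha}$ is true, and $H$ results from the natural double pushout: images of $L-K$ deleted (dangling condition: no node of $g(L-K)$ incident to an edge outside $g(L)$), images of $K$ relabelled as in $R^{g,\alpha}$, and $R-K$ added. Programs. Commands: rule set calls $\{r_1,\dots,r_n\}$,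 $P;Q$, if $C$ then $P$ else $Q$, try $C$ then $P$ else $Q$, $P!$, break, skip (call of $\emptyset\Rightarrow\emptyset$), fail (call of the empty rule set). Semantics on configurations: $\langle\mathcal R,G\rangle\to H$ if $G\Rightarrow_{\mathcal R}H$; $\langle\mathcal R,G\rangle\to\mathrm{fail}$ if no rule applies; $\langle P;Q,G\rangle\to\langle P';Q,H\rangle$ if $\langle P,G\rangle\to\langle P',H\rangle$; $\langle P;Q,G\rangle\to\langle Q,H\rangle$ if $\langle P,G\rangle\to H$; $\langle P;Q,G\rangle\to\mathrm{fail}$ if $\langle P,G\rangle\to\mathrm{fail}$; $\langle\mathrm{break};P,G\rangle\to\langle\mathrm{break},G\rangle$; if-command goes to $\langle P,G\rangle$ if $\langle C,G\rangle\to^+H$ for some $H$ and to $\langle Q,G\rangle$ if $\langle C,G\rangle\to^+\mathrm{fail}$; try-command goes to $\langle P,H\rangle$ if $\langle C,G\rangle\to^+H$ and to $\langle Q,G\rangle$ if $\langle C,G\rangle\to^+\mathrm{fail}$; $\langle P!,G\rangle\to\langle P!,H\rangle$ if $\langle P,G\rangle\to^+H$; $\langle P!,G\rangle\to G$ if $\langle P,G\rangle\to^+\mathrm{fail}$; $\langle P!,G\rangle\to H$ if $\langle P,G\rangle\to^*\langle\mathrm{break},H\rangle$. $[\![P]\!]G$ collects the host graphs $H$ with $\langle P,G\rangle\to^+H$, fail if $\langle P,G\rangle\to^+\mathrm{fail}$, and $\perp$ for diverging runs. Assertions are arbitrary properties of host graphs; $G\vDash c$ means $G$ has property $c$. A triple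 $\{c\}P\{d\}$ is partially correct if for every host graph $G\vDash c$, every host graph $H\in[\![P]\!]G$ satisfies $d$. $\mathrm{SLP}(c,P)$ / $\mathrm{WLP}(P,d)$: a liberal postcondition $d$ w.r.t. $c,P$ satisfies ($G\vDash c$ and $H\in[\![P]\!]G$) $\Rightarrow H\vDash d$; SLP is a liberal postcondition implying all others; a liberal precondition $c$ w.r.t. $P,d$ satisfies the same implication, and WLP is a liberal precondition implied by all others. $G\vDash\mathrm{SUCCESS}(P)$ iff some host graph lies in $[\![P]\!]G$; $G\vDash\mathrm{FAIL}(P)$ iff $\mathrm{fail}\in[\![P]\!]G$. $\mathrm{Break}(c,P,d)$ holds iff for all derivations $\langle P,G\rangle\to^*\langle\mathrm{break},H\rangle$, $G\vDash c$ implies $H\vDash d$. Calculus SEM (for assertions $c,d,d',e$, rule schema $r$, rule set $\mathcal R$, programs $C,P,Q$): [ruleapp$_{slp}$] $\{c\}\,r\,\{\mathrm{SLP}(c,r)\}$; [ruleapp$_{wlp}$] $\{\mathrm{WLP}(r,d)\}\,r\,\{d\}$; [ruleset] from $\{c\}r\{d\}$ for each $r\in\mathcal R$ infer $\{c\}\mathcal R\{d\}$; [comp] from $\{c\}P\{e\}$ and $\{e\}Q\{d\}$ infer $\{c\}P;Q\{d\}$; [cons] from ($c$ implies $c'$), $\{c'\}P\{d'\}$, ($d'$ implies $d$) infer $\{c\}P\{d\}$; [if] from $\{c\wedge\mathrm{SUCCESS}(C)\}P\{d\}$ and $\{c\wedge\mathrm{FAIL}(C)\}Q\{d\}$ infer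 $\{c\}\,\text{if }C\text{ then }P\text{ else }Q\,\{d\}$; [try] from $\{c\wedge\mathrm{SUCCESS}(C)\}C;P\{d\}$ and $\{c\wedge\mathrm{FAIL}(C)\}Q\{d\}$ infer $\{c\}\,\text{try }C\text{ then }P\text{ else }Q\,\{d\}$; [alap] from $\{c\}P\{c\}$ and $\mathrm{Break}(c,P,d)$ infer $\{c\}P!\{(c\wedge\mathrm{FAIL}(P))\vee d\}$. Derivability is relative: the implications in [cons] and the side condition Break are semantic facts assumed to be available (proved outside the calculus).
   Formalization: SEM has no rule for break, so the valid triple {c} break {d} is underivable; derivability in SEM is shown for programs in which break occurs only inside conditions of if-commands, and for all programs once the triples {c} break {d} are added as axioms. *)

theory Defs
  imports Main "HOL-Library.FuncSet" "HOL-Library.FSet" "HOL-Library.Signed_Division"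
begin

section \<open>Host graphs\<close>

datatype atom = IntAtom int | StrAtom string

type_synonym label = "atom list"

definition Character :: "char set" where
  "Character = {ch. 32 \<le> (of_char ch :: nat) \<and> (of_char ch :: nat) \<le> 126 \<and> (of_char ch :: nat) \<noteq> 34}"

definition atoms :: "atom set" where
  "atoms = range IntAtom \<union> StrAtom ` lists Character"

definition host_labels :: "label set" where
  "host_labels = lists atoms"

datatype node_mark = NNone | NRed | NGreen | NBlue | NGrey

datatype edge_mark = ENone | ERed | EGreen | EBlue | EDashed

text \<open>One record serves host graphs, rule graphs and instances of rule graphs; they differ in the
  types of nodes, edges, labels and marks.\<close>

record ('v, 'e, 'l, 'nm, 'em) graph =
  nodes :: "'v set"
  edges :: "'e set"
  src :: "'e \<Rightarrow> 'v"
  tgt :: "'e \<Rightarrow> 'v"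
  nlab :: "'v \<Rightarrow> 'l"
  elab :: "'e \<Rightarrow> 'l"
  nmark :: "'v \<Rightarrow> 'nm"
  emark :: "'e \<Rightarrow> 'em"
  rooted :: "'v \<Rightarrow> bool"

text \<open>The extensional function spaces make two graphs equal as soon as they agree on their nodes and
  edges, so that an assertion cannot depend on values outside the graph.\<close>

definition is_graph :: "'l set \<Rightarrow> ('v, 'e, 'l, 'nm, 'em) graph \<Rightarrow> bool" where
  "is_graph Labels G \<longleftrightarrow>
     finite (nodes G) \<and> finite (edges G) \<and>
     src G \<in> edges G \<rightarrow>\<^sub>E nodes G \<and> tgt G \<in> edges G \<rightarrow>\<^sub>E nodes G \<and>
     nlab G \<in> nodes G \<rightarrow>\<^sub>E Labels \<and> elab G \<in> edges G \<rightarrow>\<^sub>E Labels \<and>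
     nmark G \<in> nodes G \<rightarrow>\<^sub>E UNIV \<and> emark G \<in> edges G \<rightarrow>\<^sub>E UNIV \<and>
     rooted G \<in> nodes G \<rightarrow>\<^sub>E UNIV"

definition empty_graph :: "('v, 'e, 'l, 'nm, 'em) graph" where
  "empty_graph =
     \<lparr>nodes = {}, edges = {}, src = (\<lambda>_. undefined), tgt = (\<lambda>_. undefined),
      nlab = (\<lambda>_. undefined), elab = (\<lambda>_. undefined),
      nmark = (\<lambda>_. undefined), emark = (\<lambda>_. undefined), rooted = (\<lambda>_. undefined)\<rparr>"

lemma is_graph_empty: "is_graph Labels empty_graph"
  by (simp add: is_graph_def empty_graph_def)

text \<open>Host graphs are finite, so natural numbers suffice as node and edge identifiers.\<close>

typedef host_graph =
  "{G :: (nat, nat, label, node_mark, edge_mark) graph. is_graph host_labels G}"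
  morphisms graph_of Host
  using is_graph_empty by blast

definition isomorphic ::
  "('v, 'e, 'l, 'nm, 'em) graph \<Rightarrow> ('w, 'f, 'l, 'nm, 'em) graph \<Rightarrow> bool" where
  "isomorphic G H \<longleftrightarrow>
     (\<exists>fV fE. bij_betw fV (nodes G) (nodes H) \<and> bij_betw fE (edges G) (edges H) \<and>
        (\<forall>e\<in>edges G. src H (fE e) = fV (src G e) \<and> tgt H (fE e) = fV (tgt G e) \<and>
           elab H (fE e) = elab G e \<and> emark H (fE e) = emark G e) \<and>
        (\<forall>v\<in>nodes G. nlab H (fV v) = nlab G v \<and> nmark H (fV v) = nmark G v \<and>
           rooted H (fV v) = rooted G v))"


section \<open>Expressions\<close>

datatype gp_type = TList | TAtom | TInt | TString | TChar

type_synonym var = "gp_type \<times> string"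

fun values_of :: "gp_type \<Rightarrow> label set" where
  "values_of TList = host_labels"
| "values_of TAtom = {[a] | a. a \<in> atoms}"
| "values_of TInt = {[IntAtom i] | i. True}"
| "values_of TString = {[StrAtom s] | s. s \<in> lists Character}"
| "values_of TChar = {[StrAtom [ch]] | ch. ch \<in> Character}"

text \<open>The syntactic categories are nested by the subtyping of GP 2: character variables are string
  expressions, integer and string expressions are atoms, and atoms are lists of length one.
  The argument of \<open>Indeg\<close> and \<open>Outdeg\<close> is a node identifier of the left-hand side.\<close>

datatype int_exp =
    IConst int
  | IVar string
  | Add int_exp int_exp
  | Sub int_exp int_exp
  | Mult int_exp int_exp
  | Div int_exp int_exp
  | Indeg nat
  | Outdeg nat
  | Length var

datatype string_exp =
    SConst string
  | SVar string
  | CVar string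
  | Dot string_exp string_exp

datatype atom_exp = AVar string | AInt int_exp | AString string_exp

datatype list_exp = Empty | LVar string | LAtom atom_exp | Colon list_exp list_exp

primrec int_vars :: "int_exp \<Rightarrow> var set" where
  "int_vars (IConst i) = {}"
| "int_vars (IVar x) = {(TInt, x)}"
| "int_vars (Add a b) = int_vars a \<union> int_vars b"
| "int_vars (Sub a b) = int_vars a \<union> int_vars b"
| "int_vars (Mult a b) = int_vars a \<union> int_vars b"
| "int_vars (Div a b) = int_vars a \<union> int_vars b"
| "int_vars (Indeg n) = {}"
| "int_vars (Outdeg n) = {}"
| "int_vars (Length x) = {x}"

primrec int_nodes :: "int_exp \<Rightarrow> nat set" where
  "int_nodes (IConst i) = {}"
| "int_nodes (IVar x) = {}"
| "int_nodes (Add a b) = int_nodes a \<union> int_nodes b"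
| "int_nodes (Sub a b) = int_nodes a \<union> int_nodes b"
| "int_nodes (Mult a b) = int_nodes a \<union> int_nodes b"
| "int_nodes (Div a b) = int_nodes a \<union> int_nodes b"
| "int_nodes (Indeg n) = {n}"
| "int_nodes (Outdeg n) = {n}"
| "int_nodes (Length x) = {}"

primrec string_vars :: "string_exp \<Rightarrow> var set" where
  "string_vars (SConst s) = {}"
| "string_vars (SVar x) = {(TString, x)}"
| "string_vars (CVar x) = {(TChar, x)}"
| "string_vars (Dot s t) = string_vars s \<union> string_vars t"

primrec string_ok :: "string_exp \<Rightarrow> bool" where
  "string_ok (SConst s) \<longleftrightarrow> s \<in> lists Character"
| "string_ok (SVar x) \<longleftrightarrow> True"
| "string_ok (CVar x) \<longleftrightarrow> True"
| "string_ok (Dot s t) \<longleftrightarrow> string_ok s \<and> string_ok t"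

primrec atom_vars :: "atom_exp \<Rightarrow> var set" where
  "atom_vars (AVar x) = {(TAtom, x)}"
| "atom_vars (AInt i) = int_vars i"
| "atom_vars (AString s) = string_vars s"

primrec atom_nodes :: "atom_exp \<Rightarrow> nat set" where
  "atom_nodes (AVar x) = {}"
| "atom_nodes (AInt i) = int_nodes i"
| "atom_nodes (AString s) = {}"

primrec atom_ok :: "atom_exp \<Rightarrow> bool" where
  "atom_ok (AVar x) \<longleftrightarrow> True"
| "atom_ok (AInt i) \<longleftrightarrow> True"
| "atom_ok (AString s) \<longleftrightarrow> string_ok s"

primrec list_vars :: "list_exp \<Rightarrow> var set" where
  "list_vars Empty = {}"
| "list_vars (LVar x) = {(TList, x)}"
| "list_vars (LAtom a) = atom_vars a"
| "list_vars (Colon l m) = list_vars l \<union> list_vars m"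

primrec list_nodes :: "list_exp \<Rightarrow> nat set" where
  "list_nodes Empty = {}"
| "list_nodes (LVar x) = {}"
| "list_nodes (LAtom a) = atom_nodes a"
| "list_nodes (Colon l m) = list_nodes l \<union> list_nodes m"

primrec list_ok :: "list_exp \<Rightarrow> bool" where
  "list_ok Empty \<longleftrightarrow> True"
| "list_ok (LVar x) \<longleftrightarrow> True"
| "list_ok (LAtom a) \<longleftrightarrow> atom_ok a"
| "list_ok (Colon l m) \<longleftrightarrow> list_ok l \<and> list_ok m"


section \<open>Conditional rule schemata\<close>

datatype 'm rule_mark = Any | Mark 'm

type_synonym rule_graph =
  "(nat, nat, list_exp, node_mark rule_mark, edge_mark rule_mark) graph"

text \<open>\<open>EdgePred m n None\<close> asks for an edge from \<open>m\<close> to \<open>n\<close>; \<open>EdgePred m n (Some (l, k))\<close>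
  asks for one with label \<open>l\<close> and mark \<open>k\<close>.\<close>

datatype condition =
    CTrue
  | TypeTest gp_type list_exp
  | ListEq list_exp list_exp
  | ListNeq list_exp list_exp
  | Less int_exp int_exp
  | LessEq int_exp int_exp
  | Greater int_exp int_exp
  | GreaterEq int_exp int_exp
  | EdgePred nat nat "(list_exp \<times> edge_mark rule_mark) option"
  | Not condition
  | And condition condition
  | Or condition condition

primrec cond_nodes :: "condition \<Rightarrow> nat set" where
  "cond_nodes CTrue = {}"
| "cond_nodes (TypeTest t l) = list_nodes l"
| "cond_nodes (ListEq l m) = list_nodes l \<union> list_nodes m"
| "cond_nodes (ListNeq l m) = list_nodes l \<union> list_nodes m"
| "cond_nodes (Less a b) = int_nodes a \<union> int_nodes b"
| "cond_nodes (LessEq a b) = int_nodes a \<union> int_nodes b"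
| "cond_nodes (Greater a b) = int_nodes a \<union> int_nodes b"
| "cond_nodes (GreaterEq a b) = int_nodes a \<union> int_nodes b"
| "cond_nodes (EdgePred m n q) =
     {m, n} \<union> (case q of None \<Rightarrow> {} | Some (l, k) \<Rightarrow> list_nodes l)"
| "cond_nodes (Not c) = cond_nodes c"
| "cond_nodes (And c d) = cond_nodes c \<union> cond_nodes d"
| "cond_nodes (Or c d) = cond_nodes c \<union> cond_nodes d"

primrec cond_ok :: "condition \<Rightarrow> bool" where
  "cond_ok CTrue \<longleftrightarrow> True"
| "cond_ok (TypeTest t l) \<longleftrightarrow> list_ok l"
| "cond_ok (ListEq l m) \<longleftrightarrow> list_ok l \<and> list_ok m"
| "cond_ok (ListNeq l m) \<longleftrightarrow> list_ok l \<and> list_ok m"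
| "cond_ok (Less a b) \<longleftrightarrow> True"
| "cond_ok (LessEq a b) \<longleftrightarrow> True"
| "cond_ok (Greater a b) \<longleftrightarrow> True"
| "cond_ok (GreaterEq a b) \<longleftrightarrow> True"
| "cond_ok (EdgePred m n q) \<longleftrightarrow> (case q of None \<Rightarrow> True | Some (l, k) \<Rightarrow> list_ok l)"
| "cond_ok (Not c) \<longleftrightarrow> cond_ok c"
| "cond_ok (And c d) \<longleftrightarrow> cond_ok c \<and> cond_ok d"
| "cond_ok (Or c d) \<longleftrightarrow> cond_ok c \<and> cond_ok d"

record schema =
  lhs :: rule_graph
  interface :: "nat set"
  rhs :: rule_graph
  app_cond :: condition

definition graph_vars :: "rule_graph \<Rightarrow> var set" where
  "graph_vars L = (\<Union>v\<in>nodes L. list_vars (nlab L v)) \<union> (\<Union>e\<in>edges L. list_vars (elab L e))"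

definition graph_exp_nodes :: "rule_graph \<Rightarrow> nat set" where
  "graph_exp_nodes L =
     (\<Union>v\<in>nodes L. list_nodes (nlab L v)) \<union> (\<Union>e\<in>edges L. list_nodes (elab L e))"

definition is_rule_schema :: "schema \<Rightarrow> bool" where
  "is_rule_schema r \<longleftrightarrow>
     is_graph {l. list_ok l} (lhs r) \<and> is_graph {l. list_ok l} (rhs r) \<and>
     interface r \<subseteq> nodes (lhs r) \<and> interface r \<subseteq> nodes (rhs r) \<and>
     graph_vars (rhs r) \<subseteq> graph_vars (lhs r) \<and>
     cond_ok (app_cond r) \<and>
     graph_exp_nodes (lhs r) \<union> graph_exp_nodes (rhs r) \<union> cond_nodes (app_cond r)
       \<subseteq> nodes (lhs r)"

definition empty_schema :: schema where
  "empty_schema = \<lparr>lhs = empty_graph, interface = {}, rhs = empty_graph, app_cond = CTrue\<rparr>"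

lemma is_rule_schema_empty: "is_rule_schema empty_schema"
  unfolding is_rule_schema_def empty_schema_def
  by (simp add: is_graph_empty) (simp add: empty_graph_def graph_vars_def graph_exp_nodes_def)

typedef rule_schema = "{r. is_rule_schema r}"
  morphisms schema_of Rule
  using is_rule_schema_empty by blast


section \<open>Rule application\<close>

text \<open>Evaluation is relative to the host graph, the node part of the premorphism and the variable
  assignment. It is partial because of division by zero; a rule schema is not applicable if one of
  its expressions is undefined. Division truncates towards zero.\<close>

type_synonym valuation = "var \<Rightarrow> label"

definition length_of :: "var \<Rightarrow> label \<Rightarrow> int" where
  "length_of x l =
     (if fst x = TList then int (length l)
      else (case l of [StrAtom s] \<Rightarrow> int (length s) | _ \<Rightarrow> 1))"

definition lift2 :: "('a \<Rightarrow> 'b \<Rightarrow> 'c) \<Rightarrow> 'a option \<Rightarrow> 'b option \<Rightarrow> 'c option" where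
  "lift2 f x y = Option.bind x (\<lambda>a. Option.bind y (\<lambda>b. Some (f a b)))"

context
  fixes G :: host_graph and gV :: "nat \<Rightarrow> nat" and val :: valuation
begin

primrec eval_int :: "int_exp \<Rightarrow> int option" where
  "eval_int (IConst i) = Some i"
| "eval_int (IVar x) = (case val (TInt, x) of [IntAtom i] \<Rightarrow> Some i | _ \<Rightarrow> None)"
| "eval_int (Add a b) = lift2 (+) (eval_int a) (eval_int b)"
| "eval_int (Sub a b) = lift2 (-) (eval_int a) (eval_int b)"
| "eval_int (Mult a b) = lift2 (*) (eval_int a) (eval_int b)"
| "eval_int (Div a b) =
     (if eval_int b = Some 0 then None else lift2 (sdiv) (eval_int a) (eval_int b))"
| "eval_int (Indeg n) =
     Some (int (card {e \<in> edges (graph_of G). tgt (graph_of G) e = gV n}))"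
| "eval_int (Outdeg n) =
     Some (int (card {e \<in> edges (graph_of G). src (graph_of G) e = gV n}))"
| "eval_int (Length x) = Some (length_of x (val x))"

primrec eval_string :: "string_exp \<Rightarrow> string option" where
  "eval_string (SConst s) = Some s"
| "eval_string (SVar x) = (case val (TString, x) of [StrAtom s] \<Rightarrow> Some s | _ \<Rightarrow> None)"
| "eval_string (CVar x) = (case val (TChar, x) of [StrAtom s] \<Rightarrow> Some s | _ \<Rightarrow> None)"
| "eval_string (Dot s t) = lift2 (@) (eval_string s) (eval_string t)"

primrec eval_atom :: "atom_exp \<Rightarrow> atom option" where
  "eval_atom (AVar x) = (case val (TAtom, x) of [a] \<Rightarrow> Some a | _ \<Rightarrow> None)"
| "eval_atom (AInt i) = map_option IntAtom (eval_int i)"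
| "eval_atom (AString s) = map_option StrAtom (eval_string s)"

primrec eval_list :: "list_exp \<Rightarrow> label option" where
  "eval_list Empty = Some []"
| "eval_list (LVar x) = Some (val (TList, x))"
| "eval_list (LAtom a) = map_option (\<lambda>b. [b]) (eval_atom a)"
| "eval_list (Colon l m) = lift2 (@) (eval_list l) (eval_list m)"

primrec eval_cond :: "condition \<Rightarrow> bool option" where
  "eval_cond CTrue = Some True"
| "eval_cond (TypeTest t l) = map_option (\<lambda>x. x \<in> values_of t) (eval_list l)"
| "eval_cond (ListEq l m) = lift2 (=) (eval_list l) (eval_list m)"
| "eval_cond (ListNeq l m) = lift2 (\<noteq>) (eval_list l) (eval_list m)"
| "eval_cond (Less a b) = lift2 (<) (eval_int a) (eval_int b)"
| "eval_cond (LessEq a b) = lift2 (\<le>) (eval_int a) (eval_int b)"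
| "eval_cond (Greater a b) = lift2 (>) (eval_int a) (eval_int b)"
| "eval_cond (GreaterEq a b) = lift2 (\<ge>) (eval_int a) (eval_int b)"
| "eval_cond (EdgePred m n q) =
     (let E = {e \<in> edges (graph_of G). src (graph_of G) e = gV m \<and> tgt (graph_of G) e = gV n}
      in case q of
           None \<Rightarrow> Some (E \<noteq> {})
         | Some (l, k) \<Rightarrow>
             map_option (\<lambda>x. \<exists>e\<in>E. elab (graph_of G) e = x \<and>
               (k = Any \<or> k = Mark (emark (graph_of G) e))) (eval_list l))"
| "eval_cond (Not c) = map_option HOL.Not (eval_cond c)"
| "eval_cond (And c d) = lift2 (\<and>) (eval_cond c) (eval_cond d)"
| "eval_cond (Or c d) = lift2 (\<or>) (eval_cond c) (eval_cond d)"

end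

text \<open>An assignment also chooses concrete marks for the items marked \<open>Any\<close>. The choice belongs
  to the identifier of the item, so an interface node marked \<open>Any\<close> on both sides keeps the
  mark that was matched.\<close>

record assignment =
  valuation :: valuation
  nchoice :: "nat \<Rightarrow> node_mark"
  echoice :: "nat \<Rightarrow> edge_mark"

definition is_assignment :: "assignment \<Rightarrow> bool" where
  "is_assignment \<alpha> \<longleftrightarrow> (\<forall>x. valuation \<alpha> x \<in> values_of (fst x))"

fun resolve :: "'m rule_mark \<Rightarrow> 'm \<Rightarrow> 'm" where
  "resolve Any m = m"
| "resolve (Mark k) m = k"

definition evaluable :: "host_graph \<Rightarrow> (nat \<Rightarrow> nat) \<Rightarrow> assignment \<Rightarrow> rule_graph \<Rightarrow> bool" where
  "evaluable G gV \<alpha> L \<longleftrightarrow>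
     (\<forall>v\<in>nodes L. eval_list G gV (valuation \<alpha>) (nlab L v) \<noteq> None) \<and>
     (\<forall>e\<in>edges L. eval_list G gV (valuation \<alpha>) (elab L e) \<noteq> None)"

definition inst :: "host_graph \<Rightarrow> (nat \<Rightarrow> nat) \<Rightarrow> assignment \<Rightarrow> rule_graph
    \<Rightarrow> (nat, nat, label, node_mark, edge_mark) graph" where
  "inst G gV \<alpha> L =
     \<lparr>nodes = nodes L, edges = edges L, src = src L, tgt = tgt L,
      nlab = (\<lambda>v. the (eval_list G gV (valuation \<alpha>) (nlab L v))),
      elab = (\<lambda>e. the (eval_list G gV (valuation \<alpha>) (elab L e))),
      nmark = (\<lambda>v. resolve (nmark L v) (nchoice \<alpha> v)),
      emark = (\<lambda>e. resolve (emark L e) (echoice \<alpha> e)),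
      rooted = rooted L\<rparr>"

definition injective_premorphism ::
  "(nat \<Rightarrow> nat) \<Rightarrow> (nat \<Rightarrow> nat) \<Rightarrow> (nat, nat, 'l, 'nm, 'em) graph
    \<Rightarrow> (nat, nat, 'k, 'om, 'fm) graph \<Rightarrow> bool" where
  "injective_premorphism gV gE L G \<longleftrightarrow>
     gV ` nodes L \<subseteq> nodes G \<and> gE ` edges L \<subseteq> edges G \<and>
     inj_on gV (nodes L) \<and> inj_on gE (edges L) \<and>
     (\<forall>e\<in>edges L. src G (gE e) = gV (src L e) \<and> tgt G (gE e) = gV (tgt L e))"

definition preserves_labels ::
  "(nat \<Rightarrow> nat) \<Rightarrow> (nat \<Rightarrow> nat) \<Rightarrow> (nat, nat, 'l, 'nm, 'em) graph
    \<Rightarrow> (nat, nat, 'l, 'nm, 'em) graph \<Rightarrow> bool" where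
  "preserves_labels gV gE L G \<longleftrightarrow>
     (\<forall>v\<in>nodes L. nlab G (gV v) = nlab L v \<and> nmark G (gV v) = nmark L v \<and>
        rooted G (gV v) = rooted L v) \<and>
     (\<forall>e\<in>edges L. elab G (gE e) = elab L e \<and> emark G (gE e) = emark L e)"

definition dangling_condition :: "(nat \<Rightarrow> nat) \<Rightarrow> (nat \<Rightarrow> nat) \<Rightarrow> schema \<Rightarrow>
    (nat, nat, 'l, 'nm, 'em) graph \<Rightarrow> bool" where
  "dangling_condition gV gE r G \<longleftrightarrow>
     (\<forall>e \<in> edges G - gE ` edges (lhs r).
        src G e \<notin> gV ` (nodes (lhs r) - interface r) \<and>
        tgt G e \<notin> gV ` (nodes (lhs r) - interface r))"

text \<open>Node attributes of the result: \<open>h\<close> is the attribute in the host graph, \<open>k\<close> the one in the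
  right-hand side, which takes precedence on the image of the interface \<open>K\<close>.\<close>

definition overwrite ::
  "(nat \<Rightarrow> nat) \<Rightarrow> nat set \<Rightarrow> (nat \<Rightarrow> 'a) \<Rightarrow> (nat \<Rightarrow> 'a) \<Rightarrow> nat + nat \<Rightarrow> 'a" where
  "overwrite gV K h k =
     case_sum (\<lambda>v. if v \<in> gV ` K then k (the_inv_into K gV v) else h v) k"

text \<open>The result of the natural double pushout along the match: \<open>Inl\<close> tags the items kept from
  the host graph, \<open>Inr\<close> the items added by the right-hand side \<open>R\<close>. The interface has no
  edges, hence all matched edges are removed and all edges of \<open>R\<close> are added.\<close>

definition result_graph ::
  "(nat \<Rightarrow> nat) \<Rightarrow> (nat \<Rightarrow> nat) \<Rightarrow> schema \<Rightarrow> (nat, nat, 'l, 'nm, 'em) graph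
    \<Rightarrow> (nat, nat, 'l, 'nm, 'em) graph \<Rightarrow> (nat + nat, nat + nat, 'l, 'nm, 'em) graph" where
  "result_graph gV gE r R G =
     (let K = interface r;
          emb = (\<lambda>v. if v \<in> K then Inl (gV v) else Inr v)
      in \<lparr>nodes = Inl ` (nodes G - gV ` (nodes (lhs r) - K)) \<union> Inr ` (nodes R - K),
          edges = Inl ` (edges G - gE ` edges (lhs r)) \<union> Inr ` edges R,
          src = case_sum (Inl \<circ> src G) (emb \<circ> src R),
          tgt = case_sum (Inl \<circ> tgt G) (emb \<circ> tgt R),
          nlab = overwrite gV K (nlab G) (nlab R),
          elab = case_sum (elab G) (elab R),
          nmark = overwrite gV K (nmark G) (nmark R),
          emark = case_sum (emark G) (emark R),
          rooted = overwrite gV K (rooted G) (rooted R)\<rparr>)"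

definition derives :: "rule_schema \<Rightarrow> host_graph \<Rightarrow> host_graph \<Rightarrow> bool" where
  "derives r G H \<longleftrightarrow>
     (let L = lhs (schema_of r); R = rhs (schema_of r) in
      \<exists>gV gE \<alpha>. injective_premorphism gV gE L (graph_of G) \<and> is_assignment \<alpha> \<and>
        evaluable G gV \<alpha> L \<and> evaluable G gV \<alpha> R \<and>
        preserves_labels gV gE (inst G gV \<alpha> L) (graph_of G) \<and>
        eval_cond G gV (valuation \<alpha>) (app_cond (schema_of r)) = Some True \<and>
        dangling_condition gV gE (schema_of r) (graph_of G) \<and>
        isomorphic (result_graph gV gE (schema_of r) (inst G gV \<alpha> R) (graph_of G)) (graph_of H))"


section \<open>Graph programs\<close>

datatype program =
    Call "rule_schema fset"
  | Seq program program
  | IfThenElse program program program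
  | TryThenElse program program program
  | Loop program
  | Break

abbreviation Single :: "rule_schema \<Rightarrow> program" where
  "Single r \<equiv> Call {|r|}"

abbreviation Skip :: program where
  "Skip \<equiv> Single (Rule empty_schema)"

abbreviation Fail :: program where
  "Fail \<equiv> Call {||}"

datatype config = Running program host_graph | Final host_graph | Failed

lemma tranclp_mono [mono]:
  assumes "\<And>x y. r x y \<longrightarrow> s x y"
  shows "r\<^sup>+\<^sup>+ a b \<longrightarrow> s\<^sup>+\<^sup>+ a b"
proof
  assume "r\<^sup>+\<^sup>+ a b"
  then show "s\<^sup>+\<^sup>+ a b"
    by induction (use assms in \<open>blast intro: tranclp.intros\<close>)+
qed

inductive step :: "config \<Rightarrow> config \<Rightarrow> bool" where
  call: "r |\<in>| Rs \<Longrightarrow> derives r G H \<Longrightarrow> step (Running (Call Rs) G) (Final H)"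
| call_fail: "(\<And>r H. r |\<in>| Rs \<Longrightarrow> \<not> derives r G H) \<Longrightarrow> step (Running (Call Rs) G) Failed"
| seq: "step (Running P G) (Running P' H) \<Longrightarrow>
    step (Running (Seq P Q) G) (Running (Seq P' Q) H)"
| seq_final: "step (Running P G) (Final H) \<Longrightarrow> step (Running (Seq P Q) G) (Running Q H)"
| seq_fail: "step (Running P G) Failed \<Longrightarrow> step (Running (Seq P Q) G) Failed"
| break: "step (Running (Seq Break P) G) (Running Break G)"
| if_then: "step\<^sup>+\<^sup>+ (Running C G) (Final H) \<Longrightarrow>
    step (Running (IfThenElse C P Q) G) (Running P G)"
| if_else: "step\<^sup>+\<^sup>+ (Running C G) Failed \<Longrightarrow>
    step (Running (IfThenElse C P Q) G) (Running Q G)"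
| try_then: "step\<^sup>+\<^sup>+ (Running C G) (Final H) \<Longrightarrow>
    step (Running (TryThenElse C P Q) G) (Running P H)"
| try_else: "step\<^sup>+\<^sup>+ (Running C G) Failed \<Longrightarrow>
    step (Running (TryThenElse C P Q) G) (Running Q G)"
| loop: "step\<^sup>+\<^sup>+ (Running P G) (Final H) \<Longrightarrow> step (Running (Loop P) G) (Running (Loop P) H)"
| loop_end: "step\<^sup>+\<^sup>+ (Running P G) Failed \<Longrightarrow> step (Running (Loop P) G) (Final G)"
| loop_break: "step\<^sup>*\<^sup>* (Running P G) (Running Break H) \<Longrightarrow>
    step (Running (Loop P) G) (Final H)"

datatype outcome = Graph host_graph | Failure | Diverge

definition sem :: "program \<Rightarrow> host_graph \<Rightarrow> outcome set" where
  "sem P G =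
     {Graph H | H. step\<^sup>+\<^sup>+ (Running P G) (Final H)} \<union>
     (if step\<^sup>+\<^sup>+ (Running P G) Failed then {Failure} else {}) \<union>
     (if \<exists>f. f 0 = Running P G \<and> (\<forall>i::nat. step (f i) (f (Suc i))) then {Diverge} else {})"


section \<open>Assertions and the calculus SEM\<close>

type_synonym assertion = "host_graph \<Rightarrow> bool"

definition implies :: "assertion \<Rightarrow> assertion \<Rightarrow> bool" where
  "implies c d \<longleftrightarrow> (\<forall>G. c G \<longrightarrow> d G)"

definition partially_correct :: "assertion \<Rightarrow> program \<Rightarrow> assertion \<Rightarrow> bool" where
  "partially_correct c P d \<longleftrightarrow> (\<forall>G. c G \<longrightarrow> (\<forall>H. Graph H \<in> sem P G \<longrightarrow> d H))"

definition liberal_post :: "assertion \<Rightarrow> program \<Rightarrow> assertion \<Rightarrow> bool" where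
  "liberal_post c P d \<longleftrightarrow> (\<forall>G H. c G \<and> Graph H \<in> sem P G \<longrightarrow> d H)"

definition liberal_pre :: "program \<Rightarrow> assertion \<Rightarrow> assertion \<Rightarrow> bool" where
  "liberal_pre P d c \<longleftrightarrow> (\<forall>G H. c G \<and> Graph H \<in> sem P G \<longrightarrow> d H)"

definition SLP :: "assertion \<Rightarrow> program \<Rightarrow> assertion" where
  "SLP c P = (THE d. liberal_post c P d \<and> (\<forall>d'. liberal_post c P d' \<longrightarrow> implies d d'))"

definition WLP :: "program \<Rightarrow> assertion \<Rightarrow> assertion" where
  "WLP P d = (THE c. liberal_pre P d c \<and> (\<forall>c'. liberal_pre P d c' \<longrightarrow> implies c' c))"

lemma SLP_unique_existence:
  "\<exists>!d. liberal_post c P d \<and> (\<forall>d'. liberal_post c P d' \<longrightarrow> implies d d')"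
proof (rule ex1I[of _ "\<lambda>H. \<exists>G. c G \<and> Graph H \<in> sem P G"])
  fix d assume d: "liberal_post c P d \<and> (\<forall>d'. liberal_post c P d' \<longrightarrow> implies d d')"
  have "liberal_post c P (\<lambda>H. \<exists>G. c G \<and> Graph H \<in> sem P G)"
    by (auto simp: liberal_post_def)
  with d have "implies d (\<lambda>H. \<exists>G. c G \<and> Graph H \<in> sem P G)" by simp
  with d show "d = (\<lambda>H. \<exists>G. c G \<and> Graph H \<in> sem P G)"
    by (intro ext) (auto simp: implies_def liberal_post_def)
qed (auto simp: liberal_post_def implies_def)

lemma WLP_unique_existence:
  "\<exists>!c. liberal_pre P d c \<and> (\<forall>c'. liberal_pre P d c' \<longrightarrow> implies c' c)"
proof (rule ex1I[of _ "\<lambda>G. \<forall>H. Graph H \<in> sem P G \<longrightarrow> d H"])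
  fix c assume c: "liberal_pre P d c \<and> (\<forall>c'. liberal_pre P d c' \<longrightarrow> implies c' c)"
  have "liberal_pre P d (\<lambda>G. \<forall>H. Graph H \<in> sem P G \<longrightarrow> d H)"
    by (auto simp: liberal_pre_def)
  with c have "implies (\<lambda>G. \<forall>H. Graph H \<in> sem P G \<longrightarrow> d H) c" by simp
  with c show "c = (\<lambda>G. \<forall>H. Graph H \<in> sem P G \<longrightarrow> d H)"
    by (intro ext) (auto simp: implies_def liberal_pre_def)
qed (auto simp: liberal_pre_def implies_def)

definition SUCCESS :: "program \<Rightarrow> assertion" where
  "SUCCESS P G \<longleftrightarrow> (\<exists>H. Graph H \<in> sem P G)"

definition FAIL :: "program \<Rightarrow> assertion" where
  "FAIL P G \<longleftrightarrow> Failure \<in> sem P G"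

definition BREAK :: "assertion \<Rightarrow> program \<Rightarrow> assertion \<Rightarrow> bool" where
  "BREAK c P d \<longleftrightarrow>
     (\<forall>G H. step\<^sup>*\<^sup>* (Running P G) (Running Break H) \<longrightarrow> c G \<longrightarrow> d H)"

text \<open>Derivability in SEM from a set \<open>A\<close> of triples used as additional axioms. The calculus
  proper is \<open>SEM {}\<close>.\<close>

type_synonym triple = "assertion \<times> program \<times> assertion"

inductive SEM :: "triple set \<Rightarrow> assertion \<Rightarrow> program \<Rightarrow> assertion \<Rightarrow> bool"
  for A :: "triple set" where
  axiom: "(c, P, d) \<in> A \<Longrightarrow> SEM A c P d"
| ruleapp_slp: "SEM A c (Single r) (SLP c (Single r))"
| ruleapp_wlp: "SEM A (WLP (Single r) d) (Single r) d"
| ruleset: "(\<And>r. r |\<in>| Rs \<Longrightarrow> SEM A c (Single r) d) \<Longrightarrow> SEM A c (Call Rs) d"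
| comp: "SEM A c P e \<Longrightarrow> SEM A e Q d \<Longrightarrow> SEM A c (Seq P Q) d"
| cons: "implies c c' \<Longrightarrow> SEM A c' P d' \<Longrightarrow> implies d' d \<Longrightarrow> SEM A c P d"
| "if": "SEM A (\<lambda>G. c G \<and> SUCCESS C G) P d \<Longrightarrow> SEM A (\<lambda>G. c G \<and> FAIL C G) Q d \<Longrightarrow>
    SEM A c (IfThenElse C P Q) d"
| "try": "SEM A (\<lambda>G. c G \<and> SUCCESS C G) (Seq C P) d \<Longrightarrow> SEM A (\<lambda>G. c G \<and> FAIL C G) Q d \<Longrightarrow>
    SEM A c (TryThenElse C P Q) d"
| alap: "SEM A c P c \<Longrightarrow> BREAK c P d \<Longrightarrow> SEM A c (Loop P) (\<lambda>G. (c G \<and> FAIL P G) \<or> d G)"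

text \<open>None of the rules of SEM concludes a triple about the command \<open>Break\<close>, although all these
  triples are partially correct (\<open>partially_correct_Break\<close>). A program is affected by this iff \<open>Break\<close> occurs in it outside
  the conditions of if-commands, which are the only subprograms that SEM
  does not descend into (\<open>not_SEM_exposes_break\<close>).\<close>

fun exposes_break :: "program \<Rightarrow> bool" where
  "exposes_break (Call Rs) \<longleftrightarrow> False"
| "exposes_break (Seq P Q) \<longleftrightarrow> exposes_break P \<or> exposes_break Q"
| "exposes_break (IfThenElse C P Q) \<longleftrightarrow> exposes_break P \<or> exposes_break Q"
| "exposes_break (TryThenElse C P Q) \<longleftrightarrow>
     exposes_break C \<or> exposes_break P \<or> exposes_break Q"
| "exposes_break (Loop P) \<longleftrightarrow> exposes_break P"
| "exposes_break Break \<longleftrightarrow> True"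

definition break_triples :: "triple set" where
  "break_triples = {(c, Break, d) | c d. True}"

lemma step_Break: "\<not> step (Running Break G) x"
  by (rule notI, erule step.cases) simp_all

lemma partially_correct_Break: "partially_correct c Break d"
proof -
  have "Graph H \<notin> sem Break G" for G H
  proof
    assume "Graph H \<in> sem Break G"
    then have "step\<^sup>+\<^sup>+ (Running Break G) (Final H)" by (simp add: sem_def split: if_splits)
    then obtain x where "step (Running Break G) x" by (meson tranclpD)
    then show False using step_Break by blast
  qed
  then show ?thesis by (simp add: partially_correct_def)
qed

lemma not_SEM_exposes_break: "SEM {} c P d \<Longrightarrow> \<not> exposes_break P"
  by (induction rule: SEM.induct) simp_all

end

(*
  Every subprogram gets its strongest postcondition as intermediate assertion.  For a loop this is
  the set of graphs reachable at the loop head: it is closed under the body, and if the body breaks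
  or fails in such a graph, then the loop stops there, so the postcondition follows.
*)

theory Submission
  imports Defs
begin

lemma Graph_in_sem_iff: "Graph H \<in> sem P G \<longleftrightarrow> step\<^sup>+\<^sup>+ (Running P G) (Final H)"
  by (simp add: sem_def)

lemma Failure_in_sem_iff: "Failure \<in> sem P G \<longleftrightarrow> step\<^sup>+\<^sup>+ (Running P G) Failed"
  by (simp add: sem_def)

lemma step_source_Running: "step x y \<Longrightarrow> \<exists>P G. x = Running P G"
  by (erule step.cases) simp_all

text \<open>Lets a subprogram inherit partial correctness: a run of \<open>Q\<close> from
  \<open>G'\<close> prolongs the steps leading there to a run of \<open>P\<close>.\<close>

lemma partially_correct_step_Running:
  assumes "partially_correct c P d" "c G" "step\<^sup>+\<^sup>+ (Running P G) (Running Q G')"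
    and "Graph H \<in> sem Q G'"
  shows "d H"
  using assms by (auto simp: partially_correct_def Graph_in_sem_iff dest: tranclp_trans)

text \<open>Induction from the front of the run: every step of \<open>P\<close> but the last is
  lifted by \<open>seq\<close>, the last by \<open>seq_final\<close>.\<close>

lemma Seq_steps_Final:
  assumes "step\<^sup>+\<^sup>+ (Running P G) (Final H)"
  shows "step\<^sup>+\<^sup>+ (Running (Seq P Q) G) (Running Q H)"
proof -
  have "step\<^sup>+\<^sup>+ (Running (Seq P Q) G) (Running Q H)"
    if "step\<^sup>+\<^sup>+ x (Final H)" "x = Running P G" for x P G
    using that
  proof (induction arbitrary: P G rule: converse_tranclp_induct)
    case (base x)
    then show ?case by (blast intro: seq_final)
  next
    case (step x y)
    \<comment> \<open>\<open>y\<close> still has a step ahead of it, which neither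
      \<open>Final\<close> nor \<open>Failed\<close> has.\<close>
    obtain P' G' where y: "y = Running P' G'"
      using step.hyps(2) step_source_Running by (meson tranclpD)
    have "step (Running (Seq P Q) G) (Running (Seq P' Q) G')"
      using step.hyps(1) step.prems y by (blast intro: seq)
    then show ?case using step.IH[OF y] by (rule tranclp_into_tranclp2)
  qed
  then show ?thesis using assms by blast
qed

lemma SLP_implies:
  assumes "partially_correct c P d"
  shows "implies (SLP c P) d"
proof -
  have "liberal_post c P (SLP c P) \<and> (\<forall>d'. liberal_post c P d' \<longrightarrow> implies (SLP c P) d')"
    unfolding SLP_def by (rule theI'[OF SLP_unique_existence])
  moreover have "liberal_post c P d"
    using assms by (auto simp: liberal_post_def partially_correct_def)
  ultimately show ?thesis by blast
qed

text \<open>A rule call is over after one step, since \<open>Final\<close> and \<open>Failed\<close>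
  have no successors.\<close>

lemma Graph_in_sem_Single: "Graph H \<in> sem (Single r) G \<Longrightarrow> derives r G H"
  unfolding Graph_in_sem_iff
  by (drule tranclpD) (auto elim!: step.cases[of "Running (Single r) G"]
      dest: step_source_Running elim: converse_rtranclpE)

text \<open>Keeping \<open>A\<close> general lets one induction serve both calculi,
  \<open>A = {}\<close> and \<open>A = break_triples\<close>. The first premise passes to each
  subprogram that SEM descends into, because \<open>exposes_break\<close> recurses along exactly
  these.\<close>

lemma SEM_if_partially_correct:
  assumes "exposes_break P \<longrightarrow> break_triples \<subseteq> A" "partially_correct c P d"
  shows "SEM A c P d"
  using assms
proof (induction P arbitrary: c d)
  case (Call Rs)
  show ?case
  proof (rule SEM.ruleset)
    fix r assume r: "r |\<in>| Rs"
    \<comment> \<open>Every result of \<open>Single r\<close> is also a result of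
      \<open>Call Rs\<close>.\<close>
    have "partially_correct c (Single r) d"
      using Call.prems(2) step.call[OF r] Graph_in_sem_Single
      by (fastforce simp: partially_correct_def Graph_in_sem_iff)
    then show "SEM A c (Single r) d"
      by (intro SEM.cons[OF _ SEM.ruleapp_slp SLP_implies]) (simp_all add: implies_def)
  qed
next
  case (Seq P Q)
  let ?e = "\<lambda>H. \<exists>G. c G \<and> Graph H \<in> sem P G"
  have "SEM A c P ?e"
    using Seq.prems(1) by (intro Seq.IH(1)) (auto simp: partially_correct_def)
  moreover have "partially_correct ?e Q d"
    using Seq.prems(2) unfolding partially_correct_def[of ?e]
    by (auto simp: Graph_in_sem_iff[of _ P] intro: partially_correct_step_Running Seq_steps_Final)
  then have "SEM A ?e Q d" using Seq.prems(1) by (intro Seq.IH(2)) auto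
  ultimately show ?case by (rule SEM.comp)
next
  case (IfThenElse C P Q)
  \<comment> \<open>The condition enters only through its outcome, and its result is discarded: both
    branches start in the original \<open>G\<close>, so \<open>c\<close> persists.\<close>
  have "partially_correct (\<lambda>G. c G \<and> SUCCESS C G) P d"
    unfolding partially_correct_def[of _ P] SUCCESS_def Graph_in_sem_iff[of _ C]
    using partially_correct_step_Running[OF IfThenElse.prems(2)] step.if_then by blast
  moreover have "partially_correct (\<lambda>G. c G \<and> FAIL C G) Q d"
    unfolding partially_correct_def[of _ Q] FAIL_def Failure_in_sem_iff
    using partially_correct_step_Running[OF IfThenElse.prems(2)] step.if_else by blast
  ultimately show ?case
    using IfThenElse.prems(1) by (intro SEM.if IfThenElse.IH(2,3)) auto
next
  case (TryThenElse C P Q)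
  let ?e = "\<lambda>H. \<exists>G. c G \<and> Graph H \<in> sem C G"
  have "partially_correct (\<lambda>G. c G \<and> SUCCESS C G) C ?e"
    by (auto simp: partially_correct_def)
  moreover have "partially_correct ?e P d"
    unfolding partially_correct_def[of _ P] Graph_in_sem_iff[of _ C]
    using partially_correct_step_Running[OF TryThenElse.prems(2)] step.try_then by blast
  moreover have "partially_correct (\<lambda>G. c G \<and> FAIL C G) Q d"
    unfolding partially_correct_def[of _ Q] FAIL_def Failure_in_sem_iff
    using partially_correct_step_Running[OF TryThenElse.prems(2)] step.try_else by blast
  ultimately show ?case
    \<comment> \<open>The first premise of the rule concerns \<open>Seq C P\<close>, which is not a
      subprogram, so it is split by \<open>comp\<close> at \<open>?e\<close>, the graphs that
      \<open>C\<close> yields.\<close>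
    using TryThenElse.prems(1) by (intro SEM.try SEM.comp[of A _ C ?e] TryThenElse.IH) auto
next
  case (Loop P)
  let ?inv = "\<lambda>H. \<exists>G. c G \<and> step\<^sup>*\<^sup>* (Running (Loop P) G) (Running (Loop P) H)"
  \<comment> \<open>Covers both exits of the loop: with \<open>loop_break\<close> it gives the side
    condition \<open>BREAK\<close>, with \<open>loop_end\<close> the disjunct with
    \<open>FAIL\<close>.\<close>
  have final: "d H" if "?inv G" "step (Running (Loop P) G) (Final H)" for G H
    using that Loop.prems(2)
    by (auto simp: partially_correct_def Graph_in_sem_iff intro: rtranclp_into_tranclp1)
  have "partially_correct ?inv P ?inv"
    unfolding partially_correct_def Graph_in_sem_iff
    by (blast intro: step.loop rtranclp.rtrancl_into_rtrancl)
  then have "SEM A ?inv P ?inv" using Loop.prems(1) by (intro Loop.IH) auto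
  moreover have "BREAK ?inv P d"
    using final step.loop_break unfolding BREAK_def by blast
  ultimately have "SEM A ?inv (Loop P) (\<lambda>G. (?inv G \<and> FAIL P G) \<or> d G)"
    by (rule SEM.alap)
  moreover have "implies c ?inv" by (auto simp: implies_def)
  moreover have "implies (\<lambda>G. (?inv G \<and> FAIL P G) \<or> d G) d"
    using final step.loop_end unfolding implies_def FAIL_def Failure_in_sem_iff by blast
  ultimately show ?case by (blast intro: SEM.cons)
next
  case Break
  \<comment> \<open>\<open>Break\<close> exposes itself, so the premise on \<open>A\<close> supplies
    the triple as an axiom.\<close>
  then show ?case by (auto simp: break_triples_def intro: SEM.axiom)
qed

theorem mainTheorem3:
  fixes P :: program and c d :: assertion
  assumes "partially_correct c P d"
  shows "(\<not> exposes_break P \<longrightarrow> SEM {} c P d) \<and> SEM break_triples c P d"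
  using assms by (simp add: SEM_if_partially_correct)

end
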